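(* For any number of iterations $i\ge1$ and any parameters $L,M,B,W$, both the block system and the coupled system can be constructed (i.e. the stream length $N$, the factorization $M=M_1M_2$ and the permutation matrices $\mathbf{P}_l$ can be chosen) such that the corresponding system graph has girth larger than $4i$.
   Context: Data streams. Stream $l$ consists of $N$ symbols $v_{1,l},\dots,v_{N,l}$ from a constellation with $2^B$ points. Each symbol is replicated $M_1$ times, the resulting $NM_1$ symbols are permuted by an $NM_1\times NM_1$ permutation matrix $\mathbf{P}_l$ specific to stream $l$, and each permuted symbol is multiplied by a signature sequence of length $M_2$, giving a transmitted sequence $\tilde v_{1,l},\dots,\tilde v_{MN,l}$ of length $MN$, where $M=M_1M_2$. So each symbol $v_{j,l}$ contributes to exactly $M$ of the transmitted positions of stream $l$. System graph. This is a bipartite graph whose variable nodes are the symbols $v_{j,l}$ and whose channel nodes are the received samples $y_t$; $v_{j,l}$ is adjacent to $y_t$ iff a replica of $v_{j,l}$ is transmitted at time $t$. Block system: streams $l=1,\dots,L$ are transmitted simultaneously, so $\tilde v_{t,l}$ contributes to $y_t$ for $t=1,\dots,MN$ and all $l$. Coupled system (regularized delays, window parameter $W$): $2W+1$ divides $L$ and $MN$; put $L_W=L/(2W+1)$, $N_W=MN/(2W+1)$. There are infinitely many streams, sent in groups of $L_W$ streams; the $k$-th group ($k=0,1,2,\dots$) has delay $kN_W$, and $\tilde v_{s,l}$ of a stream $l$ with delay $\tau_l$ contributes to $y_{s+\tau_l}$. The graph is thus an infinite chain with variable nodes of degree $M$ and channel nodes of degree $L$ (less near the start). The girth of a graph is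 the length of its shortest cycle ($\infty$ if there is none). *)

theory Defs
  imports
    "HOL-Library.Extended_Nat"
    "HOL-Combinatorics.Permutations"
    "Jordan_Normal_Form.Matrix"
begin

section \<open>Simple graphs and girth\<close>

text \<open>A simple graph is a pair of a vertex set and a set of two-element vertex sets; either may be
  infinite. A cycle is given by the list of its distinct vertices, without repeating the first one.\<close>

type_synonym 'a ugraph = "'a set \<times> 'a set set"

definition verts :: "'a ugraph \<Rightarrow> 'a set" where
  "verts G = fst G"

definition edges :: "'a ugraph \<Rightarrow> 'a set set" where
  "edges G = snd G"

definition is_cycle :: "'a ugraph \<Rightarrow> 'a list \<Rightarrow> bool" where
  "is_cycle G p \<longleftrightarrow>
     3 \<le> length p \<and> distinct p \<and> set p \<subseteq> verts G \<and>
     (\<forall>k < length p. {p ! k, p ! (Suc k mod length p)} \<in> edges G)"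

text \<open>The infimum over the empty set is \<open>\<infinity>\<close>, so acyclic graphs have girth \<open>\<infinity>\<close>.\<close>

definition girth :: "'a ugraph \<Rightarrow> enat" where
  "girth G = (INF p \<in> {p. is_cycle G p}. enat (length p))"


section \<open>Data streams\<close>

definition permutation_matrix :: "nat \<Rightarrow> real mat \<Rightarrow> bool" where
  "permutation_matrix n A \<longleftrightarrow>
     (\<exists>p. p permutes {..<n} \<and> A = mat n n (\<lambda>(r, c). if r = p c then 1 else 0))"

text \<open>Symbols, streams, positions and times are numbered from 0. The replicated sequence of a
  stream is \<open>u q = v (q div M1)\<close> for \<open>q < N * M1\<close>, i.e. every symbol is repeated \<open>M1\<close> times in a row.
  Multiplying by the permutation matrix \<open>P\<close> puts \<open>u q\<close> in place \<open>r\<close> iff \<open>P $$ (r, q) = 1\<close>, and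
  spreading by a signature sequence of length \<open>M2\<close> sends the entry in place \<open>r\<close> at the positions
  \<open>r * M2, \<dots>, r * M2 + M2 - 1\<close>. Only the positions of the replicas matter for the system graph: the
  constellation of \<open>2 ^ B\<close> points and the values of the signature sequences do not enter.\<close>

definition replica_at :: "nat \<Rightarrow> nat \<Rightarrow> nat \<Rightarrow> real mat \<Rightarrow> nat \<Rightarrow> nat \<Rightarrow> bool" where
  "replica_at N M1 M2 P j s \<longleftrightarrow>
     s < N * M1 * M2 \<and> (\<exists>q < N * M1. q div M1 = j \<and> P $$ (s div M2, q) = 1)"


section \<open>System graphs\<close>

text \<open>\<open>Var j l\<close> is the symbol \<open>j\<close> of stream \<open>l\<close> and \<open>Chan t\<close> is the received sample at time \<open>t\<close>.\<close>

datatype node = Var nat nat | Chan nat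

text \<open>The graph of a system with set of streams \<open>S\<close>, in which stream \<open>l\<close> has delay \<open>\<tau> l\<close> and
  permutation matrix \<open>P l\<close>. The received samples are those at times when some stream is active.\<close>

definition system_graph ::
  "nat set \<Rightarrow> (nat \<Rightarrow> nat) \<Rightarrow> nat \<Rightarrow> nat \<Rightarrow> nat \<Rightarrow> (nat \<Rightarrow> real mat) \<Rightarrow> node ugraph" where
  "system_graph S \<tau> N M1 M2 P =
     ({Var j l | j l. j < N \<and> l \<in> S} \<union> {Chan (s + \<tau> l) | s l. s < N * M1 * M2 \<and> l \<in> S},
      {{Var j l, Chan (s + \<tau> l)} | j l s. j < N \<and> l \<in> S \<and> replica_at N M1 M2 (P l) j s})"

text \<open>\<open>valid_design S M N M1 M2 P\<close>: an admissible choice of the stream length, of the factorization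
  of \<open>M\<close> and of the permutation matrices of the streams in \<open>S\<close>.\<close>

definition valid_design ::
  "nat set \<Rightarrow> nat \<Rightarrow> nat \<Rightarrow> nat \<Rightarrow> nat \<Rightarrow> (nat \<Rightarrow> real mat) \<Rightarrow> bool" where
  "valid_design S M N M1 M2 P \<longleftrightarrow>
     0 < N \<and> M = M1 * M2 \<and> (\<forall>l \<in> S. permutation_matrix (N * M1) (P l))"

definition block_design :: "nat \<Rightarrow> nat \<Rightarrow> nat \<Rightarrow> nat \<Rightarrow> nat \<Rightarrow> (nat \<Rightarrow> real mat) \<Rightarrow> bool" where
  "block_design L M N M1 M2 P \<longleftrightarrow> valid_design {..<L} M N M1 M2 P"

definition block_graph :: "nat \<Rightarrow> nat \<Rightarrow> nat \<Rightarrow> nat \<Rightarrow> (nat \<Rightarrow> real mat) \<Rightarrow> node ugraph" where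
  "block_graph L N M1 M2 P = system_graph {..<L} (\<lambda>_. 0) N M1 M2 P"

text \<open>The streams of the coupled system are all natural numbers; the \<open>k\<close>-th group consists of the
  streams \<open>k * L_W, \<dots>, (k + 1) * L_W - 1\<close>, where \<open>L_W = L div (2 * W + 1)\<close>.\<close>

definition coupled_design ::
  "nat \<Rightarrow> nat \<Rightarrow> nat \<Rightarrow> nat \<Rightarrow> nat \<Rightarrow> nat \<Rightarrow> (nat \<Rightarrow> real mat) \<Rightarrow> bool" where
  "coupled_design L M W N M1 M2 P \<longleftrightarrow>
     2 * W + 1 dvd L \<and> 2 * W + 1 dvd M * N \<and> valid_design UNIV M N M1 M2 P"

definition coupled_delay :: "nat \<Rightarrow> nat \<Rightarrow> nat \<Rightarrow> nat \<Rightarrow> nat \<Rightarrow> nat" where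
  "coupled_delay L M W N l =
     (let L_W = L div (2 * W + 1); N_W = M * N div (2 * W + 1) in (l div L_W) * N_W)"

definition coupled_graph ::
  "nat \<Rightarrow> nat \<Rightarrow> nat \<Rightarrow> nat \<Rightarrow> nat \<Rightarrow> (nat \<Rightarrow> real mat) \<Rightarrow> node ugraph" where
  "coupled_graph L W N M1 M2 P =
     system_graph UNIV (coupled_delay L (M1 * M2) W N) N M1 M2 P"

end

theory Submission
  imports Defs
begin

text \<open>Take \<open>M1 = M\<close> and \<open>M2 = 1\<close>: a stream is then an arbitrary partition of the times into blocks
  of \<open>M\<close>. The partitions are the orbits of \<open>L\<close> maps of order \<open>M\<close> on a finite set \<open>A\<close>, and
  a cycle of length \<open>2 * m\<close> in the system graph gives a closed walk in \<open>A\<close> of \<open>m\<close> steps, consecutive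
  ones being nontrivial rotations by different maps. Such short walks are impossible in a suitable
  \<open>A\<close>: the factors of the free product of \<open>L\<close> cyclic groups of order \<open>M\<close> act on the words of bounded
  length, with trivial action where a word would become too long. A short walk from the empty word
  never returns to it. Replacing the set of words by its symmetric group, acted on by
  composition, moves this property from the empty word to every starting point.

  In the coupled system the \<open>L\<close> streams that are active at any one time are distinct modulo \<open>L\<close>. Hence
  stream \<open>l\<close> can use the partition number \<open>l mod L\<close> of a block system, with times read modulo \<open>M * N\<close>;
  this wraps the coupled graph onto the block graph locally injectively, so cycles still become
  closed reduced walks.\<close>

section \<open>Rotation steps and reduced walks\<close>

definition rot_step :: "('c \<Rightarrow> 'a \<Rightarrow> 'a) \<Rightarrow> nat \<Rightarrow> 'c \<Rightarrow> 'a \<Rightarrow> 'a \<Rightarrow> bool" where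
  "rot_step f M c a b \<longleftrightarrow> (\<exists>e. 0 < e \<and> e < M \<and> b = (f c ^^ e) a)"

text \<open>The last condition says that no nonempty reduced word of at most \<open>R\<close>
  letters in the free product of \<open>L\<close> cyclic groups of order \<open>M\<close> fixes a
  point of \<open>A\<close>. As \<open>c (m - 1) = c 0\<close> is allowed, a closed walk needs no
  check at the place where it closes up.\<close>

definition free_rotations :: "nat \<Rightarrow> nat \<Rightarrow> nat \<Rightarrow> 'a set \<Rightarrow> (nat \<Rightarrow> 'a \<Rightarrow> 'a) \<Rightarrow> bool" where
  "free_rotations L M R A f \<longleftrightarrow>
     finite A \<and>
     (\<forall>l < L. \<forall>a \<in> A. f l a \<in> A \<and> (f l ^^ M) a = a) \<and>
     (\<forall>m x c. 0 < m \<longrightarrow> m \<le> R \<longrightarrow> x 0 \<in> A \<longrightarrow>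
        (\<forall>k < m. c k < L \<and> rot_step f M (c k) (x k) (x (Suc k))) \<longrightarrow>
        (\<forall>k. Suc k < m \<longrightarrow> c k \<noteq> c (Suc k)) \<longrightarrow> x m \<noteq> x 0)"

section \<open>Cyclic rotations of words\<close>

definition starts :: "'c \<Rightarrow> ('c \<times> nat) list \<Rightarrow> bool" where
  "starts l w \<longleftrightarrow> w \<noteq> [] \<and> fst (hd w) = l"

text \<open>A letter \<open>(l, e)\<close> stands for the \<open>e\<close>-th power of the generator
  of factor \<open>l\<close>.\<close>

definition words :: "nat \<Rightarrow> nat \<Rightarrow> nat \<Rightarrow> (nat \<times> nat) list set" where
  "words L M R = {w. set w \<subseteq> {..<L} \<times> {1..<M} \<and> length w \<le> R}"

text \<open>For a word \<open>u\<close> of length less than \<open>R\<close> that does not start with \<open>l\<close>, this map runs through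
  \<open>u\<close>, \<open>(l, 1) # u\<close>, \<dots>, \<open>(l, M - 1) # u\<close> cyclically. Non-reduced words are fixed, so that they
  need not be excluded.\<close>

definition word_rot :: "nat \<Rightarrow> nat \<Rightarrow> nat \<Rightarrow> nat \<Rightarrow> (nat \<times> nat) list \<Rightarrow> (nat \<times> nat) list" where
  "word_rot L M R l w =
     (if w \<notin> words L M R then w
      else if starts l w then
        (if starts l (tl w) then w
         else if Suc (snd (hd w)) < M then (l, Suc (snd (hd w))) # tl w else tl w)
      else if length w < R \<and> 1 < M then (l, 1) # w else w)"

lemma finite_words: "finite (words L M R)"
  unfolding words_def by (rule finite_lists_length_le) simp

lemma word_rot_in: "l < L \<Longrightarrow> w \<in> words L M R \<Longrightarrow> word_rot L M R l w \<in> words L M R"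
  by (cases w) (auto simp: word_rot_def words_def starts_def)

lemma word_rot_pow_Cons:
  assumes "l < L" "u \<in> words L M R" "length u < R" "\<not> starts l u" "0 < e" "e < M"
  shows "(word_rot L M R l ^^ e) u = (l, e) # u"
  using assms(5,6)
proof (induction e)
  case (Suc e)
  show ?case
  proof (cases "e = 0")
    case True
    then show ?thesis using assms Suc.prems by (simp add: word_rot_def)
  next
    case False
    have "(l, e) # u \<in> words L M R"
      using assms Suc.prems False by (auto simp: words_def)
    then show ?thesis using assms Suc False by (simp add: word_rot_def starts_def)
  qed
qed simp

text \<open>After \<open>M - 1\<close> rotations the front letter is \<open>(l, M - 1)\<close>, and
  one more deletes it. For \<open>M = 1\<close> there are no letters, and the rotation is the
  identity.\<close>

lemma word_rot_period_aux:
  assumes "l < L" "u \<in> words L M R" "length u < R" "\<not> starts l u" "1 \<le> M"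
  shows "(word_rot L M R l ^^ M) u = u"
proof (cases "M = 1")
  case True
  then show ?thesis using assms by (simp add: word_rot_def)
next
  case False
  then obtain e where e: "M = Suc e" "0 < e" using assms(5) by (cases M) auto
  have "(l, e) # u \<in> words L M R"
    using assms e by (auto simp: words_def)
  then show ?thesis
    using assms e word_rot_pow_Cons[OF assms(1-4), of e] by (simp add: word_rot_def starts_def)
qed

lemma funpow_fixpoint: "f x = x \<Longrightarrow> (f ^^ n) x = x"
  by (induction n) auto

lemma word_rot_period:
  assumes "l < L" "1 \<le> M"
  shows "(word_rot L M R l ^^ M) w = w"
proof -
  consider "word_rot L M R l w = w"
    | "w \<in> words L M R" "\<not> starts l w" "length w < R"
    | "w \<in> words L M R" "starts l w" "\<not> starts l (tl w)"
    unfolding word_rot_def by meson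
  then show ?thesis
  proof cases
    case 1
    then show ?thesis by (rule funpow_fixpoint)
  next
    case 2
    then show ?thesis using word_rot_period_aux assms by blast
  next
    case 3
    then obtain e u where w: "w = (l, e) # u" by (cases w) (auto simp: starts_def)
    have u: "u \<in> words L M R" "length u < R" "\<not> starts l u" "0 < e" "e < M"
      using 3 w by (auto simp: words_def)
    have weq: "w = (word_rot L M R l ^^ e) u"
      using word_rot_pow_Cons[of l L u M R e] assms u w by simp
    \<comment> \<open>Powers of one map commute, so the period passes from \<open>u\<close> to its
      image \<open>w\<close>.\<close>
    have "(word_rot L M R l ^^ M) w = (word_rot L M R l ^^ e) ((word_rot L M R l ^^ M) u)"
      unfolding weq by (metis add.commute comp_apply funpow_add)
    then show ?thesis using word_rot_period_aux assms u weq by simp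
  qed
qed

text \<open>By periodicity the power with exponent \<open>M - 1\<close> is a left inverse; on a
  finite set injectivity suffices.\<close>

lemma word_rot_permutes:
  assumes "l < L" "1 \<le> M"
  shows "word_rot L M R l permutes words L M R"
proof (rule bij_imp_permutes)
  let ?f = "word_rot L M R l"
  obtain n where n: "M = Suc n" using assms(2) by (cases M) auto
  have "inj_on ?f (words L M R)"
  proof (rule inj_on_inverseI)
    show "(?f ^^ n) (?f w) = w" for w
      using word_rot_period[OF assms, of R w] unfolding n funpow_Suc_right by simp
  qed
  then show "bij_betw ?f (words L M R) (words L M R)"
    using word_rot_in[OF assms(1)] finite_words
    by (simp add: bij_betw_def endo_inj_surj image_subset_iff)
qed (simp add: word_rot_def)

text \<open>A rotation whose index differs from that of the front letter prepends a letter, and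
  \<open>m \<le> R\<close> leaves room for it. So the word records the walk, and its length shows
  that it has not come back to \<open>[]\<close>.\<close>

lemma word_rot_walk:
  assumes "1 \<le> m" "m \<le> R"
    and "\<And>k. k < m \<Longrightarrow> c k < L \<and> rot_step (word_rot L M R) M (c k) (y k) (y (Suc k))"
    and "\<And>k. Suc k < m \<Longrightarrow> c k \<noteq> c (Suc k)"
    and "y 0 = []"
  shows "y m \<in> words L M R \<and> length (y m) = m \<and> starts (c (m - 1)) (y m)"
  using assms(1-4)
proof (induction m rule: dec_induct)
  case base
  obtain e where e: "0 < e" "e < M" "y 1 = (word_rot L M R (c 0) ^^ e) (y 0)" "c 0 < L"
    using base by (auto simp: rot_step_def)
  have "y 1 = [(c 0, e)]"
    unfolding e(3) assms(5)
    using word_rot_pow_Cons[of "c 0" L "[]" M R e] base e by (simp add: words_def starts_def)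
  then show ?case using e(1,2,4) base(1) by (simp add: words_def starts_def)
next
  case (step m)
  have IH: "y m \<in> words L M R \<and> length (y m) = m \<and> starts (c (m - 1)) (y m)"
    using step by (intro step.IH) auto
  have "c (m - 1) \<noteq> c m" using step.prems(3)[of "m - 1"] step.hyps by simp
  then have ns: "\<not> starts (c m) (y m)" using IH by (simp add: starts_def)
  obtain e where e: "0 < e" "e < M" "y (Suc m) = (word_rot L M R (c m) ^^ e) (y m)" "c m < L"
    using step.prems(2)[of m] by (auto simp: rot_step_def)
  then have "y (Suc m) = (c m, e) # y m"
    using word_rot_pow_Cons[of "c m" L "y m" M R e] IH ns step.prems(1) by simp
  then show ?case using e IH step.prems(1) by (auto simp: words_def starts_def)
qed

text \<open>The factor \<open>{..<K}\<close> only serves to make the number of times divisible by \<open>2 * W + 1\<close>.\<close>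

lemma free_rotations_exist:
  assumes "1 \<le> M" "1 \<le> K"
  obtains A :: "(((nat \<times> nat) list \<Rightarrow> (nat \<times> nat) list) \<times> nat) set" and f
  where "free_rotations L M R A f" "A \<noteq> {}" "K dvd card A"
proof -
  let ?X = "words L M R"
  define f where "f l = (\<lambda>(p :: (nat \<times> nat) list \<Rightarrow> _, k). (word_rot L M R l \<circ> p, k :: nat))" for l
  define A where "A = {p. p permutes ?X} \<times> {..<K}"
  have pow: "(f l ^^ e) a = ((word_rot L M R l ^^ e) \<circ> fst a, snd a)" for l e a
    by (induction e) (auto simp: f_def o_def)
  have fin: "finite A"
    unfolding A_def using finite_permutations[OF finite_words] by blast
  have ne: "A \<noteq> {}"
    using permutes_id[of ?X] assms(2) by (auto simp: A_def lessThan_empty_iff simp del: permutes_id)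
  have closed: "f l a \<in> A \<and> (f l ^^ M) a = a" if "l < L" "a \<in> A" for l a
  proof
    show "f l a \<in> A"
      using that word_rot_permutes[OF that(1) assms(1)]
      by (auto simp: A_def f_def intro: permutes_compose)
    show "(f l ^^ M) a = a"
      unfolding pow using word_rot_period[OF that(1) assms(1)]
      by (simp add: o_def)
  qed
  have walk: "x m \<noteq> x 0"
    if m: "0 < m" "m \<le> R" and x0: "x 0 \<in> A"
      and st: "\<forall>k < m. c k < L \<and> rot_step f M (c k) (x k) (x (Suc k))"
      and dis: "\<forall>k. Suc k < m \<longrightarrow> c k \<noteq> c (Suc k)" for m x c
  proof -
    have perm: "fst (x 0) permutes ?X" using x0 by (auto simp: A_def)
    \<comment> \<open>Evaluation at the point that the starting permutation sends to
      \<open>[]\<close> turns the walk of permutations into a walk of words from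
      \<open>[]\<close>.\<close>
    obtain z where z: "fst (x 0) z = []"
      using permutes_surj[OF perm] by (metis surjD)
    define y where "y k = fst (x k) z" for k
    have "rot_step (word_rot L M R) M (c k) (y k) (y (Suc k))" if "k < m" for k
      using st that unfolding rot_step_def y_def pow by fastforce
    then have "length (y m) = m"
      using word_rot_walk[of m R c L M y] st m dis z by (simp add: y_def)
    then show ?thesis using m(1) z by (auto simp: y_def)
  qed
  have "free_rotations L M R A f"
    unfolding free_rotations_def using fin closed walk by blast
  moreover have "K dvd card A" by (simp add: A_def card_cartesian_product)
  ultimately show thesis using that ne by blast
qed

section \<open>Enumerating orbits\<close>

text \<open>All orbits have exactly \<open>M\<close> elements, so they can be listed one after the
  other, each as a block of \<open>M\<close> indices. The induction splits off one orbit at a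
  time.\<close>

lemma orbit_enumeration:
  assumes "finite A" "1 \<le> M"
    and "\<And>a. a \<in> A \<Longrightarrow> f a \<in> A \<and> (f ^^ M) a = a"
    and "\<And>a e. a \<in> A \<Longrightarrow> 0 < e \<Longrightarrow> e < M \<Longrightarrow> (f ^^ e) a \<noteq> a"
  shows "\<exists>N h. bij_betw h {..<N * M} A \<and>
    (\<forall>q < N * M. h q = (f ^^ (q mod M)) (h (q div M * M)))"
  using assms(1,3,4)
proof (induction A rule: finite_psubset_induct)
  case (psubset A)
  show ?case
  proof (cases "A = {}")
    case True
    then show ?thesis by (intro exI[of _ 0]) (simp add: bij_betw_def)
  next
    case False
    then obtain a where a: "a \<in> A" by blast
    have powA: "(f ^^ e) b \<in> A" if "b \<in> A" for e b
      using that psubset.prems(1) by (induction e) auto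
    define Orb where "Orb = (\<lambda>e. (f ^^ e) a) ` {..<M}"
    have OA: "Orb \<subseteq> A" using powA a by (auto simp: Orb_def)
    have aO: "a \<in> Orb" using assms(2) by (auto simp: Orb_def intro!: image_eqI[of _ _ 0])
    have fO: "(f ^^ n) a \<in> Orb" for n
      using funpow_mod_eq[where f = f and n = M and x = a and m = n] psubset.prems(1)[OF a] assms(2)
      by (auto simp: Orb_def intro!: image_eqI[of _ _ "n mod M"])
    \<comment> \<open>This makes \<open>A - Orb\<close> closed under \<open>f\<close>, as the
      induction hypothesis requires.\<close>
    have preOrb: "b \<in> Orb" if b: "b \<in> A" "f b \<in> Orb" for b
    proof -
      obtain e where e: "f b = (f ^^ e) a" using b by (auto simp: Orb_def)
      have "b = (f ^^ (M - 1)) (f b)"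
        using psubset.prems(1)[OF b(1)] assms(2)
        by (metis One_nat_def Suc_pred comp_apply funpow_Suc_right less_eq_Suc_le)
      also have "\<dots> = (f ^^ (M - 1 + e)) a" by (simp add: e funpow_add)
      finally show ?thesis using fO by simp
    qed
    have inj: "inj_on (\<lambda>e. (f ^^ e) a) {..<M}"
    proof (rule linorder_inj_onI)
      fix d e assume de: "d < e" "d \<in> {..<M}" "e \<in> {..<M}"
      have "(f ^^ e) a = (f ^^ (e - d)) ((f ^^ d) a)"
        using de by (simp flip: funpow_add comp_apply[of "f ^^ _" "f ^^ _"])
      then show "(f ^^ d) a \<noteq> (f ^^ e) a"
        using psubset.prems(2)[OF powA[OF a], of "e - d" d] de less_imp_diff_less[of e M d] by auto
    qed auto
    obtain N h where h: "bij_betw h {..<N * M} (A - Orb)"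
      and hq: "\<And>q. q < N * M \<Longrightarrow> h q = (f ^^ (q mod M)) (h (q div M * M))"
      using psubset.IH[of "A - Orb"] a aO psubset.prems preOrb by blast
    \<comment> \<open>The removed orbit becomes the last block, number \<open>N\<close>.\<close>
    define h' where "h' q = (if q < N * M then h q else (f ^^ (q - N * M)) a)" for q
    have b1: "bij_betw h' {..<N * M} (A - Orb)"
      using h by (subst bij_betw_cong[of _ _ h]) (auto simp: h'_def)
    have b2: "bij_betw h' {N * M..<Suc N * M} Orb"
    proof -
      have "bij_betw (\<lambda>e. (f ^^ e) a) {..<M} Orb"
        using inj by (simp add: bij_betw_def Orb_def)
      moreover have "bij_betw (\<lambda>q. q - N * M) {N * M..<Suc N * M} {..<M}"
        by (rule bij_betw_byWitness[of _ "\<lambda>e. e + N * M"]) auto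
      ultimately have "bij_betw ((\<lambda>e. (f ^^ e) a) \<circ> (\<lambda>q. q - N * M)) {N * M..<Suc N * M} Orb"
        by (rule bij_betw_trans[rotated])
      then show ?thesis
        by (subst bij_betw_cong[where g = "(\<lambda>e. (f ^^ e) a) \<circ> (\<lambda>q. q - N * M)"]) (auto simp: h'_def)
    qed
    have "bij_betw h' ({..<N * M} \<union> {N * M..<Suc N * M}) ((A - Orb) \<union> Orb)"
      by (rule bij_betw_combine[OF b1 b2]) auto
    moreover have "{..<N * M} \<union> {N * M..<Suc N * M} = {..<Suc N * M}" by auto
    moreover have "(A - Orb) \<union> Orb = A" using OA by auto
    ultimately have "bij_betw h' {..<Suc N * M} A" by simp
    moreover have "h' q = (f ^^ (q mod M)) (h' (q div M * M))" if q: "q < Suc N * M" for q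
    proof (cases "q < N * M")
      case True
      then have "q div M * M < N * M"
        using div_times_less_eq_dividend le_less_trans by blast
      then show ?thesis
        using hq[OF True] True unfolding h'_def by presburger
    next
      case False
      then have qN: "q div M = N"
        using q by (intro div_nat_eqI) (auto simp: mult.commute)
      then have "q - N * M = q mod M"
        by (simp flip: minus_div_mult_eq_mod)
      then show ?thesis using False qN by (simp add: h'_def)
    qed
    ultimately show ?thesis by blast
  qed
qed

text \<open>Indices with equal \<open>q div M\<close> are the replicas of one symbol. They fill one
  orbit, so passing between two of them is a nontrivial rotation.\<close>

lemma free_rotations_enumeration:
  assumes fr: "free_rotations L M R A f" and "1 \<le> M" "1 \<le> R" "l < L"
  obtains N h where "bij_betw h {..<N * M} A"
    and "\<And>q q'. q < N * M \<Longrightarrow> q' < N * M \<Longrightarrow> q div M = q' div M \<Longrightarrow> q \<noteq> q' \<Longrightarrow>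
      rot_step f M l (h q) (h q')"
proof -
  have per: "f l a \<in> A \<and> (f l ^^ M) a = a" if "a \<in> A" for a
    using fr that assms(4) by (simp add: free_rotations_def)
  have powA: "(f l ^^ e) a \<in> A" if "a \<in> A" for a e
    using that per by (induction e) auto
  \<comment> \<open>Freeness is the case of walks of one step, available because
    \<open>1 \<le> R\<close>.\<close>
  have free: "(f l ^^ e) a \<noteq> a" if "a \<in> A" "0 < e" "e < M" for a e
  proof -
    have "\<forall>m x c. 0 < m \<longrightarrow> m \<le> R \<longrightarrow> x 0 \<in> A \<longrightarrow>
        (\<forall>k < m. c k < L \<and> rot_step f M (c k) (x k) (x (Suc k))) \<longrightarrow>
        (\<forall>k. Suc k < m \<longrightarrow> c k \<noteq> c (Suc k)) \<longrightarrow> x m \<noteq> x 0"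
      using fr by (simp add: free_rotations_def)
    from this[rule_format, of 1 "\<lambda>k. (f l ^^ (k * e)) a" "\<lambda>_. l"]
    show ?thesis using that assms by (auto simp: rot_step_def)
  qed
  obtain N h where h: "bij_betw h {..<N * M} A"
    and hq: "\<And>q. q < N * M \<Longrightarrow> h q = (f l ^^ (q mod M)) (h (q div M * M))"
    using orbit_enumeration[of A M "f l"] fr per free assms(2)
    unfolding free_rotations_def by blast
  have hA: "h q \<in> A" if "q < N * M" for q using h that by (auto simp: bij_betw_def)
  have "rot_step f M l (h q) (h q')"
    if q: "q < N * M" "q' < N * M" "q div M = q' div M" "q \<noteq> q'" for q q'
  proof -
    define r where "r = h (q div M * M)"
    have rA: "r \<in> A" unfolding r_def using q(1)
      by (intro hA) (metis div_times_less_eq_dividend le_less_trans)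
    \<comment> \<open>The difference of the two offsets modulo \<open>M\<close>; adding
      \<open>M\<close> first avoids truncated subtraction.\<close>
    define e where "e = (q' mod M + (M - q mod M)) mod M"
    have "(f l ^^ e) (h q) = (f l ^^ (q' mod M + (M - q mod M))) (h q)"
      unfolding e_def using funpow_mod_eq per hA q(1) by metis
    also have "\<dots> = (f l ^^ (q' mod M + (M - q mod M) + q mod M)) r"
      using hq[OF q(1)] by (simp add: r_def funpow_add)
    also have "q' mod M + (M - q mod M) + q mod M = q' mod M + M"
      using mod_less_divisor[of M q] assms(2) by linarith
    also have "(f l ^^ (q' mod M + M)) r = h q'"
      using hq[OF q(2)] per[OF rA] q(3) by (simp add: r_def funpow_add)
    finally have eq: "h q' = (f l ^^ e) (h q)" by simp
    have "h q \<noteq> h q'" using h q by (auto simp: bij_betw_def inj_on_def)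
    then have "0 < e" using eq by (cases "e = 0") auto
    moreover have "e < M" using assms(2) by (simp add: e_def)
    ultimately show ?thesis using eq by (auto simp: rot_step_def)
  qed
  then show thesis using that h by blast
qed

section \<open>Cycles of system graphs\<close>

text \<open>A stream is active during \<open>M * N\<close> consecutive times, so these stay distinct
  when read modulo \<open>M * N\<close>.\<close>

lemma mod_inj_on_window: "inj_on (\<lambda>t. t mod n) {a..<a + n :: nat}"
proof (rule linorder_inj_onI)
  fix s t assume st: "s < t" "s \<in> {a..<a + n}" "t \<in> {a..<a + n}"
  then have "0 < t - s" "t - s < n" by auto
  then show "s mod n \<noteq> t mod n"
    using mod_eq_dvd_iff_nat[of s t n] mod_eq_dvd_iff_nat[of t s n] st by (auto dest: nat_dvd_not_less)
qed auto

text \<open>By bipartiteness the cycle alternates: symbol number \<open>k\<close> lies between the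
  times \<open>t k\<close> and \<open>t (Suc k)\<close>.\<close>

lemma system_graph_cycle:
  assumes cyc: "is_cycle (system_graph S \<tau> N M1 M2 P) p"
  obtains m t j l where "length p = 2 * m" "2 \<le> m" "t m = t 0"
    and "\<And>k. k < m \<Longrightarrow> t k \<noteq> t (Suc k)"
    and "\<And>k. k < m \<Longrightarrow> (j k, l k) \<noteq> (j (Suc k), l (Suc k))"
    and "\<And>k. k < m \<Longrightarrow> {Var (j k) (l k), Chan (t k)} \<in> edges (system_graph S \<tau> N M1 M2 P)"
    and "\<And>k. k < m \<Longrightarrow> {Var (j k) (l k), Chan (t (Suc k))} \<in> edges (system_graph S \<tau> N M1 M2 P)"
proof -
  let ?E = "edges (system_graph S \<tau> N M1 M2 P)"
  define n where "n = length p"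
  have n: "3 \<le> n" and dis: "distinct p"
    and edge: "\<And>k. k < n \<Longrightarrow> {p ! k, p ! (Suc k mod n)} \<in> ?E"
    using cyc by (auto simp: is_cycle_def n_def)
  define ch where "ch v = (\<exists>t. v = Chan t)" for v
  \<comment> \<open>The shift makes the walk start at a channel node.\<close>
  define a where "a = (if ch (p ! 0) then 0 else 1 :: nat)"
  define v where "v k = p ! ((k + a) mod n)" for k
  have vE: "{v k, v (Suc k)} \<in> ?E" for k
    using edge[of "(k + a) mod n"] n by (simp add: v_def mod_Suc_eq)
  have alt_edge: "ch w \<longleftrightarrow> \<not> ch u" if "{u, w} \<in> ?E" for u w
    using that by (auto simp: system_graph_def edges_def ch_def doubleton_eq_iff)
  have alt: "ch (v (Suc k)) \<longleftrightarrow> \<not> ch (v k)" for k using alt_edge[OF vE] .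
  have "ch (v 0)"
    using alt_edge[OF edge[of 0]] n by (auto simp: v_def a_def)
  then have par: "ch (v k) \<longleftrightarrow> even k" for k
    by (induction k) (auto simp: alt)
  have vper: "v (k + n) = v k" for k
    by (metis v_def add.assoc add.commute mod_add_self2)
  have "even n" using par[of n] par[of 0] vper[of 0] by simp
  then obtain m where m: "n = 2 * m" by blast
  \<comment> \<open>Vertices two apart could coincide only if \<open>n dvd 2\<close>, which
    \<open>3 \<le> n\<close> excludes.\<close>
  have v2: "v k \<noteq> v (k + 2)" for k
  proof
    assume "v k = v (k + 2)"
    then have "(k + a) mod n = (k + a + 2) mod n"
      using nth_eq_iff_index_eq[OF dis, of "(k + a) mod n" "(k + a + 2) mod n"]
        mod_less_divisor[of n] n
      by (simp add: v_def add.commute add.left_commute flip: n_def)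
    then have "n dvd 2" using mod_eq_dvd_iff_nat[of "k + a" "k + a + 2" n] by simp
    then show False using n by (auto dest: dvd_imp_le)
  qed
  define t where "t k = (THE s. v (2 * k) = Chan s)" for k
  have tk: "v (2 * k) = Chan (t k)" for k
    using par[of "2 * k"] by (auto simp: t_def ch_def)
  have "\<exists>j l. v (2 * k + 1) = Var j l" for k
    using par[of "2 * k + 1"] by (cases "v (2 * k + 1)") (auto simp: ch_def)
  then obtain j l where jl: "\<And>k. v (2 * k + 1) = Var (j k) (l k)" by metis
  show thesis
  proof (rule that[of m t j l])
    show "length p = 2 * m" "2 \<le> m" using m n n_def by auto
    show "t m = t 0" using vper[of 0] tk[of 0] tk[of m] m by simp
    show "t k \<noteq> t (Suc k)" for k using v2[of "2 * k"] tk[of k] tk[of "Suc k"] by auto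
    show "(j k, l k) \<noteq> (j (Suc k), l (Suc k))" for k
      using v2[of "2 * k + 1"] jl[of k] jl[of "Suc k"] by auto
    show "{Var (j k) (l k), Chan (t k)} \<in> ?E" for k
      using vE[of "2 * k"] tk[of k] jl[of k] by (simp add: insert_commute)
    show "{Var (j k) (l k), Chan (t (Suc k))} \<in> ?E" for k
      using vE[of "2 * k + 1"] tk[of "Suc k"] jl[of k] by simp
  qed
qed

text \<open>Here \<open>g\<close> labels times modulo \<open>M * N\<close> and
  \<open>h (col l)\<close> labels the replicas of stream \<open>l\<close>, both by points of
  \<open>A\<close>; \<open>P\<close> sends a replica to the time with its label. The times along a
  cycle thus trace a walk in \<open>A\<close>, with one rotation per symbol passed.\<close>

lemma girth_system_graph:
  fixes L M R N :: nat and S :: "nat set" and \<tau> :: "nat \<Rightarrow> nat"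
    and P :: "nat \<Rightarrow> real mat" and col :: "nat \<Rightarrow> nat"
    and h :: "nat \<Rightarrow> nat \<Rightarrow> 'a" and g :: "nat \<Rightarrow> 'a"
  assumes fr: "free_rotations L M R A f"
    and h: "\<And>l. l < L \<Longrightarrow> bij_betw (h l) {..<N * M} A"
    and rot: "\<And>l q q'. l < L \<Longrightarrow> q < N * M \<Longrightarrow> q' < N * M \<Longrightarrow> q div M = q' div M \<Longrightarrow> q \<noteq> q' \<Longrightarrow>
      rot_step f M l (h l q) (h l q')"
    and g: "bij_betw g {..<N * M} A"
    and col: "\<And>l. l \<in> S \<Longrightarrow> col l < L"
    and coinj: "\<And>l l' t. l \<in> S \<Longrightarrow> l' \<in> S \<Longrightarrow> \<tau> l \<le> t \<Longrightarrow> t < \<tau> l + N * M \<Longrightarrow>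
      \<tau> l' \<le> t \<Longrightarrow> t < \<tau> l' + N * M \<Longrightarrow> col l = col l' \<Longrightarrow> l = l'"
    and P: "\<And>l s q. l \<in> S \<Longrightarrow> s < N * M \<Longrightarrow> q < N * M \<Longrightarrow>
      P l $$ (s, q) = 1 \<Longrightarrow> g ((s + \<tau> l) mod (N * M)) = h (col l) q"
  shows "enat (2 * R) < girth (system_graph S \<tau> N M 1 P)"
proof -
  let ?G = "system_graph S \<tau> N M 1 P"
  define T where "T = N * M"
  define x where "x t = g (t mod T)" for t
  have E: "l \<in> S \<and> \<tau> l \<le> t \<and> t < \<tau> l + T \<and> (\<exists>q < T. q div M = j \<and> x t = h (col l) q)"
    if e: "{Var j l, Chan t} \<in> edges ?G" for j l t
  proof -
    obtain s where s: "t = s + \<tau> l" "l \<in> S" "replica_at N M 1 (P l) j s"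
      using e by (auto simp: system_graph_def edges_def doubleton_eq_iff)
    then show ?thesis using P[of l s] by (auto simp: replica_at_def x_def T_def)
  qed
  have "2 * R < length p" if cyc: "is_cycle ?G p" for p
  proof (rule ccontr)
    assume short: "\<not> 2 * R < length p"
    obtain m t j l where len: "length p = 2 * m" "2 \<le> m" and t: "t m = t 0"
      and tne: "\<And>k. k < m \<Longrightarrow> t k \<noteq> t (Suc k)"
      and vne: "\<And>k. k < m \<Longrightarrow> (j k, l k) \<noteq> (j (Suc k), l (Suc k))"
      and e1: "\<And>k. k < m \<Longrightarrow> {Var (j k) (l k), Chan (t k)} \<in> edges ?G"
      and e2: "\<And>k. k < m \<Longrightarrow> {Var (j k) (l k), Chan (t (Suc k))} \<in> edges ?G"
      using system_graph_cycle[OF cyc] by metis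
    define c where "c k = col (l k)" for k
    have step: "c k < L \<and> rot_step f M (c k) (x (t k)) (x (t (Suc k)))" if k: "k < m" for k
    proof -
      have lS: "l k \<in> S" and win: "\<tau> (l k) \<le> t k" "t k < \<tau> (l k) + T"
          "\<tau> (l k) \<le> t (Suc k)" "t (Suc k) < \<tau> (l k) + T"
        using E[OF e1[OF k]] E[OF e2[OF k]] by auto
      obtain q q' where q: "q < T" "q' < T" "q div M = q' div M"
          "x (t k) = h (c k) q" "x (t (Suc k)) = h (c k) q'"
        using E[OF e1[OF k]] E[OF e2[OF k]] by (auto simp: c_def)
      \<comment> \<open>Both times lie in the window of the stream \<open>l k\<close>, so reduction
        modulo \<open>T\<close> keeps them apart.\<close>
      have "t k mod T \<noteq> t (Suc k) mod T"
      proof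
        assume eq: "t k mod T = t (Suc k) mod T"
        have "t k = t (Suc k)"
          using mod_inj_on_window[of T "\<tau> (l k)"] win eq by (auto dest: inj_onD)
        then show False using tne[OF k] by simp
      qed
      then have "x (t k) \<noteq> x (t (Suc k))"
        using inj_onD[OF bij_betw_imp_inj_on[OF g], of "t k mod T" "t (Suc k) mod T"] q(1)
        by (auto simp: x_def simp flip: T_def)
      then have "q \<noteq> q'" using q by auto
      then show ?thesis using rot[of "c k" q q'] q col[OF lS] by (simp add: c_def T_def)
    qed
    \<comment> \<open>Streams of the same colour that meet at time \<open>t (Suc k)\<close> are
      equal by \<open>coinj\<close>. Injectivity of \<open>h (c k)\<close> then makes the replicas,
      and hence the symbols, equal.\<close>
    have "c k \<noteq> c (Suc k)" if k: "Suc k < m" for k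
    proof
      assume ceq: "c k = c (Suc k)"
      have k': "k < m" using k by simp
      note E1 = E[OF e2[OF k']] and E2 = E[OF e1[OF k]]
      have leq: "l k = l (Suc k)"
        using E1 E2 ceq coinj[of "l k" "l (Suc k)" "t (Suc k)"] by (simp add: c_def T_def)
      have "inj_on (h (c k)) {..<T}"
        using h[of "c k"] step[OF k'] by (simp add: bij_betw_def T_def)
      then have "j k = j (Suc k)"
        using E1 E2 ceq by (force simp: c_def dest: inj_onD)
      then show False using vne[OF k'] leq by simp
    qed
    moreover have "x (t 0) \<in> A"
    proof -
      have "0 < T" using E[OF e1[of 0]] len(2) by (cases "T = 0") auto
      then show ?thesis using g by (auto simp: x_def T_def bij_betw_def)
    qed
    moreover have "0 < m" "m \<le> R" using len short by auto
    ultimately have "x (t m) \<noteq> x (t 0)"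
      using fr[unfolded free_rotations_def, THEN conjunct2, THEN conjunct2, rule_format,
          of m "\<lambda>k. x (t k)" c] step by blast
    then show False using t by simp
  qed
  \<comment> \<open>Strict bounds do not pass to an infimum in general, so the bound is first made
    non-strict.\<close>
  then have "enat (Suc (2 * R)) \<le> girth ?G"
    unfolding girth_def by (intro INF_greatest) (simp add: Suc_le_eq)
  then show ?thesis by (rule less_le_trans[rotated]) simp
qed

section \<open>Designs of large girth\<close>

text \<open>The permutation is \<open>h\<close> followed by the inverse of \<open>g\<close>,
  continued by the identity outside \<open>{..<n}\<close>.\<close>

lemma permutation_matrix_exists:
  assumes "bij_betw g {..<n} A" "bij_betw h {..<n} A"
  obtains P where "permutation_matrix n P"
    and "\<And>s q. s < n \<Longrightarrow> q < n \<Longrightarrow> P $$ (s, q) = 1 \<longleftrightarrow> g s = h q"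
proof -
  let ?k = "\<lambda>q. the_inv_into {..<n} g (h q)"
  have k: "bij_betw ?k {..<n} {..<n}"
    using bij_betw_trans[OF assms(2) bij_betw_the_inv_into[OF assms(1)]] by (simp add: o_def)
  define \<pi> where "\<pi> q = (if q < n then ?k q else q)" for q
  have "bij_betw \<pi> {..<n} {..<n}"
    using k by (subst bij_betw_cong[of _ _ ?k]) (auto simp: \<pi>_def)
  then have perm: "\<pi> permutes {..<n}"
    by (rule bij_imp_permutes) (auto simp: \<pi>_def)
  let ?P = "mat n n (\<lambda>(r, c). if r = \<pi> c then 1 else 0) :: real mat"
  have "?P $$ (s, q) = 1 \<longleftrightarrow> g s = h q" if "s < n" "q < n" for s q
  proof -
    have "h q \<in> g ` {..<n}" using assms that by (auto simp: bij_betw_def)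
    then have "s = \<pi> q \<longleftrightarrow> g s = h q"
      using assms that f_the_inv_into_f[of g "{..<n}" "h q"] the_inv_into_f_f[of g "{..<n}" s]
      by (auto simp: \<pi>_def bij_betw_def)
    then show ?thesis using that by simp
  qed
  moreover have "permutation_matrix n ?P"
    unfolding permutation_matrix_def using perm by blast
  ultimately show thesis using that by blast
qed

lemma bij_betw_rotate: "bij_betw (\<lambda>s. (s + d) mod n) {..<n} {..<n :: nat}"
proof (cases "n = 0")
  case False
  have "inj_on (\<lambda>s. (s + d) mod n) {..<n}"
  proof (rule inj_onI)
    fix s r assume "s \<in> {..<n}" "r \<in> {..<n}" "(s + d) mod n = (r + d) mod n"
    then show "s = r"
      using inj_onD[OF mod_inj_on_window[of n d], of "s + d" "r + d"] by auto
  qed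
  then show ?thesis
    using False by (simp add: bij_betw_def endo_inj_surj image_subset_iff)
qed (simp add: bij_betw_def)

text \<open>\<open>N\<close> is fixed before \<open>S\<close>, \<open>\<tau>\<close> and
  \<open>col\<close>, because the delays of the coupled system depend on it.\<close>

lemma system_design_exists:
  fixes L M R K :: nat
  assumes "1 \<le> L" "1 \<le> M" "1 \<le> R" "1 \<le> K"
  obtains N where "0 < N" "K dvd N * M"
    and "\<And>S \<tau> col. (\<And>l. l \<in> S \<Longrightarrow> col l < L) \<Longrightarrow>
      (\<And>l l' t. l \<in> S \<Longrightarrow> l' \<in> S \<Longrightarrow> \<tau> l \<le> t \<Longrightarrow> t < \<tau> l + N * M \<Longrightarrow>
        \<tau> l' \<le> t \<Longrightarrow> t < \<tau> l' + N * M \<Longrightarrow> col l = col l' \<Longrightarrow> l = l') \<Longrightarrow>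
      \<exists>P. valid_design S M N M 1 P \<and> enat (2 * R) < girth (system_graph S \<tau> N M 1 P)"
proof -
  obtain A :: "(((nat \<times> nat) list \<Rightarrow> (nat \<times> nat) list) \<times> nat) set" and f
    where fr: "free_rotations L M R A f" and ne: "A \<noteq> {}" and K: "K dvd card A"
    using free_rotations_exist assms by metis
  define N where "N = card A div M"
  have "\<exists>h. bij_betw h {..<N * M} A \<and>
      (\<forall>q < N * M. \<forall>q' < N * M. q div M = q' div M \<longrightarrow> q \<noteq> q' \<longrightarrow> rot_step f M l (h q) (h q'))"
    if l: "l < L" for l
  proof -
    obtain N' h where h: "bij_betw h {..<N' * M} A"
      "\<forall>q < N' * M. \<forall>q' < N' * M. q div M = q' div M \<longrightarrow> q \<noteq> q' \<longrightarrow> rot_step f M l (h q) (h q')"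
      by (rule free_rotations_enumeration[OF fr assms(2,3) l]) (use that in simp)
    \<comment> \<open>Each enumeration exhausts \<open>A\<close>, so the number of blocks is the
      same for all \<open>l\<close>.\<close>
    have "card A = N' * M"
      using bij_betw_same_card[OF h(1)] by simp
    then have "N' = N" using assms(2) by (simp add: N_def)
    then show ?thesis using h by blast
  qed
  then obtain h where h: "\<And>l. l < L \<Longrightarrow> bij_betw (h l) {..<N * M} A"
    and rot: "\<And>l q q'. l < L \<Longrightarrow> q < N * M \<Longrightarrow> q' < N * M \<Longrightarrow> q div M = q' div M \<Longrightarrow> q \<noteq> q' \<Longrightarrow>
      rot_step f M l (h l q) (h l q')"
    by metis
  \<comment> \<open>Any bijection can label the times; \<open>h 0\<close> is available because
    \<open>1 \<le> L\<close>.\<close>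
  have g: "bij_betw (h 0) {..<N * M} A" using h assms(1) by simp
  have NM: "N * M = card A" using bij_betw_same_card[OF g] by simp
  have "card A \<noteq> 0" using ne fr by (simp add: free_rotations_def)
  then have N0: "0 < N" using NM by (cases "N = 0") auto
  show thesis
  proof (rule that[OF N0])
    show "K dvd N * M" using K NM by simp
    fix S :: "nat set" and \<tau> :: "nat \<Rightarrow> nat" and col :: "nat \<Rightarrow> nat"
    assume col: "\<And>l. l \<in> S \<Longrightarrow> col l < L"
      and coinj: "\<And>l l' t. l \<in> S \<Longrightarrow> l' \<in> S \<Longrightarrow> \<tau> l \<le> t \<Longrightarrow> t < \<tau> l + N * M \<Longrightarrow>
        \<tau> l' \<le> t \<Longrightarrow> t < \<tau> l' + N * M \<Longrightarrow> col l = col l' \<Longrightarrow> l = l'"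
    have "\<exists>Q. permutation_matrix (N * M) Q \<and> (\<forall>s < N * M. \<forall>q < N * M.
        Q $$ (s, q) = 1 \<longrightarrow> h 0 ((s + \<tau> l) mod (N * M)) = h (col l) q)" if l: "l \<in> S" for l
    proof -
      have "bij_betw (\<lambda>s. h 0 ((s + \<tau> l) mod (N * M))) {..<N * M} A"
        using bij_betw_trans[OF bij_betw_rotate g, of "\<tau> l"] by (simp add: o_def)
      then show ?thesis
        using permutation_matrix_exists[OF _ h[OF col[OF l]]] by metis
    qed
    then obtain P where P: "\<And>l. l \<in> S \<Longrightarrow> permutation_matrix (N * M) (P l)"
      "\<And>l s q. l \<in> S \<Longrightarrow> s < N * M \<Longrightarrow> q < N * M \<Longrightarrow> P l $$ (s, q) = 1 \<Longrightarrow>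
        h 0 ((s + \<tau> l) mod (N * M)) = h (col l) q"
      by metis
    have "valid_design S M N M 1 P" using P N0 by (simp add: valid_design_def)
    moreover have "enat (2 * R) < girth (system_graph S \<tau> N M 1 P)"
      by (rule girth_system_graph[OF fr h rot g col coinj P(2)])
    ultimately show "\<exists>P. valid_design S M N M 1 P \<and>
        enat (2 * R) < girth (system_graph S \<tau> N M 1 P)" by blast
  qed
qed

text \<open>Such streams are at least \<open>L\<close> apart, hence at least
  \<open>2 * W + 1\<close> groups apart, and so many group delays add up to \<open>M * N\<close>. In
  the proof \<open>a\<close> and \<open>b\<close> are the group size and the group delay.\<close>

lemma coupled_delay_mod_inj:
  assumes "1 \<le> L" "2 * W + 1 dvd L" "2 * W + 1 dvd M * N" "l mod L = l' mod L" "l < l'"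
  shows "coupled_delay L M W N l + N * M \<le> coupled_delay L M W N l'"
proof -
  define w where "w = 2 * W + 1"
  obtain a b where a: "L = w * a" and b: "M * N = w * b"
    using assms(2,3) unfolding w_def by blast
  have w0: "0 < w" by (simp add: w_def)
  have a0: "0 < a" using assms(1) a by (cases "a = 0") auto
  have "L dvd l' - l" using assms(4,5) mod_eq_dvd_iff_nat[of l l' L] by simp
  then have "L \<le> l' - l" using assms(5) by (simp add: dvd_imp_le)
  then have "l + w * a \<le> l'" using a assms(5) by linarith
  then have "(l + w * a) div a \<le> l' div a" by (rule div_le_mono)
  then have "l div a + w \<le> l' div a" using a0 by simp
  then have "(l div a + w) * b \<le> l' div a * b" by (rule mult_le_mono1)
  moreover have "coupled_delay L M W N k = k div a * b" for k
    unfolding coupled_delay_def Let_def w_def[symmetric] a b using w0 by simp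
  ultimately show ?thesis using b by (simp add: algebra_simps)
qed

section \<open>The block and the coupled system\<close>

theorem lemma1:
  fixes i L M B W :: nat
  assumes "1 \<le> i" and "1 \<le> L" and "1 \<le> M"
  shows "(\<exists>N M1 M2 P. block_design L M N M1 M2 P \<and>
            enat (4 * i) < girth (block_graph L N M1 M2 P)) \<and>
         (2 * W + 1 dvd L \<longrightarrow>
          (\<exists>N M1 M2 P. coupled_design L M W N M1 M2 P \<and>
            enat (4 * i) < girth (coupled_graph L W N M1 M2 P)))"
proof (rule system_design_exists)
  \<comment> \<open>Taking \<open>R\<close> as \<open>2 * i\<close> gives the bound
    \<open>4 * i\<close>; taking \<open>K\<close> as \<open>2 * W + 1\<close> gives the divisibility
    required for coupling.\<close>
  show "1 \<le> L" "1 \<le> M" "1 \<le> 2 * i" "1 \<le> 2 * W + 1" using assms by auto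
next
  fix N
  assume N: "0 < N" "2 * W + 1 dvd N * M"
    and ex: "\<And>S \<tau> col. (\<And>l. l \<in> S \<Longrightarrow> col l < L) \<Longrightarrow>
      (\<And>l l' t. l \<in> S \<Longrightarrow> l' \<in> S \<Longrightarrow> \<tau> l \<le> t \<Longrightarrow> t < \<tau> l + N * M \<Longrightarrow>
        \<tau> l' \<le> t \<Longrightarrow> t < \<tau> l' + N * M \<Longrightarrow> col l = col l' \<Longrightarrow> l = l') \<Longrightarrow>
      \<exists>P. valid_design S M N M 1 P \<and> enat (2 * (2 * i)) < girth (system_graph S \<tau> N M 1 P)"
  have "\<exists>P. valid_design {..<L} M N M 1 P \<and>
      enat (2 * (2 * i)) < girth (system_graph {..<L} (\<lambda>_. 0) N M 1 P)"
    \<comment> \<open>All streams are active at all times, so each gets a colour of its own: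
      \<open>col\<close> is \<open>id\<close>.\<close>
    by (rule ex[of _ id]) auto
  then have block: "\<exists>P. block_design L M N M 1 P \<and> enat (4 * i) < girth (block_graph L N M 1 P)"
    by (simp add: block_design_def block_graph_def)
  have coupled: "\<exists>P. coupled_design L M W N M 1 P \<and>
      enat (4 * i) < girth (coupled_graph L W N M 1 P)" if W: "2 * W + 1 dvd L"
  proof -
    have W': "2 * W + 1 dvd M * N" using N(2) by (simp add: mult.commute)
    have "\<exists>P. valid_design UNIV M N M 1 P \<and>
        enat (2 * (2 * i)) < girth (system_graph UNIV (coupled_delay L M W N) N M 1 P)"
    proof (rule ex[of _ "\<lambda>l. l mod L"])
      show "l mod L < L" for l using assms(2) by simp
      fix l l' t
      let ?\<tau> = "coupled_delay L M W N"
      assume *: "?\<tau> l \<le> t" "t < ?\<tau> l + N * M" "?\<tau> l' \<le> t" "t < ?\<tau> l' + N * M"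
        "l mod L = l' mod L"
      show "l = l'"
      proof (rule linorder_cases)
        assume "l < l'"
        then show ?thesis using coupled_delay_mod_inj[OF assms(2) W W' *(5)] * by simp
      next
        assume "l' < l"
        then show ?thesis using coupled_delay_mod_inj[OF assms(2) W W' *(5)[symmetric]] * by simp
      qed
    qed
    then show ?thesis using W W' by (simp add: coupled_design_def coupled_graph_def)
  qed
  show ?thesis using block coupled by blast
qed

end
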